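(* For a planar convex body $K\subset\mathbb{R}^2$ and $p\in\mathrm{bd}K$ let $\angle_K(p)\in(0,\pi]$ denote the angle of $K$ at $p$. For every $\varepsilon>0$: (i) there exist a planar convex body $K$ and a point $x\in\mathrm{bd}K$ with $\angle_K(x)\le \pi/3+\varepsilon$ such that $x$ is not a diametral point of $K$; (ii) there exist a planar convex body $K$ and two distinct points $x,y\in\mathrm{bd}K$ with $\angle_K(x)+\angle_K(y)\le 5\pi/6+\varepsilon$ such that neither $x$ nor $y$ is a diametral point of $K$; (iii) there exist a planar convex body $K$ and three distinct points $x,y,z\in\mathrm{bd}K$ with $\angle_K(x)+\angle_K(y)+\angle_K(z)\le 4\pi/3+\varepsilon$ such that none of $x,y,z$ is a diametral point of $K$.
   Context: A planar convex body is a compact convex subset of $\mathbb{R}^2$ with non-empty interior; $\mathrm{bd}K$ is its boundary. For $p\in\mathrm{bd}K$, the angle $\angle_K(p)$ of $K$ at $p$ is the angular measure of the closure of $\{p+t(q-p): q\in K,\ t\ge 0\}$. A diameter of $K$ is a line-segment in $K$ whose length equals the maximal Euclidean distance between pairs of points of $K$. A diametral point of $K$ is an endpoint of some diameter of $K$. *)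

theory Defs
  imports "HOL-Analysis.Analysis"
begin

definition planar_convex_body :: "(real^2) set \<Rightarrow> bool" where
  "planar_convex_body K \<longleftrightarrow> compact K \<and> convex K \<and> interior K \<noteq> {}"

definition tangent_cone_at :: "(real^2) set \<Rightarrow> real^2 \<Rightarrow> (real^2) set" where
  "tangent_cone_at K p = closure {p + t *\<^sub>R (q - p) | q t. q \<in> K \<and> 0 \<le> t}"

text \<open>The angular measure of a cone \<open>C\<close> with apex \<open>p\<close> is the length, in radians, of the
  set of directions of the rays from \<open>p\<close> that lie in \<open>C\<close>.\<close>

definition angular_measure :: "real^2 \<Rightarrow> (real^2) set \<Rightarrow> real" where
  "angular_measure p C =
     measure lebesgue {\<theta>. - pi < \<theta> \<and> \<theta> \<le> pi \<and> p + vector [cos \<theta>, sin \<theta>] \<in> C}"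

definition body_angle :: "(real^2) set \<Rightarrow> real^2 \<Rightarrow> real" where
  "body_angle K p = angular_measure p (tangent_cone_at K p)"

text \<open>\<open>is_diameter K a b\<close>: the segment with endpoints \<open>a\<close> and \<open>b\<close> is a diameter of \<open>K\<close>. The
  library's number \<^const>\<open>diameter\<close> is a supremum of distances, attained on compact nonempty \<open>K\<close>.\<close>

definition is_diameter :: "(real^2) set \<Rightarrow> real^2 \<Rightarrow> real^2 \<Rightarrow> bool" where
  "is_diameter K a b \<longleftrightarrow> closed_segment a b \<subseteq> K \<and> dist a b = diameter K"

definition diametral_point :: "(real^2) set \<Rightarrow> real^2 \<Rightarrow> bool" where
  "diametral_point K x \<longleftrightarrow> (\<exists>a b. is_diameter K a b \<and> (x = a \<or> x = b))"

end

theory Submission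
  imports Defs
begin

text \<open>A single pentagon serves all three parts. Take \<open>a = (-1, 0)\<close>, \<open>b = (1, 0)\<close>,
  \<open>x = (0, sqrt 3 - t)\<close>, \<open>y = (1 - t\<^sup>2, -t)\<close> and \<open>z = (-(1 - t\<^sup>2), -t)\<close> with small \<open>t > 0\<close>.
  The points \<open>a, b\<close> are at distance \<open>2\<close>, while every other pair of vertices is closer
  than \<open>2\<close>: moving \<open>y, z\<close> inwards only by \<open>t\<^sup>2\<close> is enough to compensate the vertical offset
  \<open>t\<close>. So \<open>x, y, z\<close> are not diametral. The angle at \<open>x\<close> is \<open>2 * arctan (1 / (sqrt 3 - t))\<close> and
  the angles at \<open>y\<close> and \<open>z\<close> are \<open>pi / 2 + arctan t\<close>; they tend to \<open>pi / 3\<close> and \<open>pi / 2\<close>.\<close>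

lemma dist_vector_2:
  "dist (vector [a, b] :: real^2) (vector [c, d]) = sqrt ((a - c)\<^sup>2 + (b - d)\<^sup>2)"
  by (simp add: dist_vec_def L2_set_def sum_2 dist_real_def)

lemma inner_vector_2: "(vector [a, b] :: real^2) \<bullet> v = a * v $ 1 + b * v $ 2"
  by (simp add: inner_vec_def sum_2)

text \<open>A half-plane with \<open>p\<close> on its bounding line is closed and stable under
  scaling from \<open>p\<close>, so it absorbs both the rays and the closure that build the
  cone.\<close>

lemma tangent_cone_at_subset_halfspace:
  assumes "K \<subseteq> {q. 0 \<le> u \<bullet> (q - p)}"
  shows "tangent_cone_at K p \<subseteq> {q. 0 \<le> u \<bullet> (q - p)}"
  unfolding tangent_cone_at_def
proof (rule closure_minimal)
  have "{q. 0 \<le> u \<bullet> (q - p)} = {q. u \<bullet> q \<ge> u \<bullet> p}"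
    by (simp add: inner_diff_right)
  then show "closed {q. 0 \<le> u \<bullet> (q - p)}"
    by (simp add: closed_halfspace_ge)
qed (use assms in auto)

text \<open>Two half-planes through \<open>p\<close> confine the tangent cone to a wedge, whose
  directions fill at most \<open>{\<alpha>..\<beta>}\<close>. Only this outer bound matters, so the
  cone itself is never computed.\<close>

lemma body_angle_le:
  assumes "K \<subseteq> {q. 0 \<le> u \<bullet> (q - p)}" "K \<subseteq> {q. 0 \<le> w \<bullet> (q - p)}" "\<alpha> \<le> \<beta>"
    and "\<And>\<theta>. \<lbrakk>- pi < \<theta>; \<theta> \<le> pi; 0 \<le> u \<bullet> vector [cos \<theta>, sin \<theta>];
           0 \<le> w \<bullet> vector [cos \<theta>, sin \<theta>]\<rbrakk> \<Longrightarrow> \<alpha> \<le> \<theta> \<and> \<theta> \<le> \<beta>"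
  shows "body_angle K p \<le> \<beta> - \<alpha>"
proof -
  let ?f = "\<lambda>\<theta>. p + vector [cos \<theta>, sin \<theta>] :: real^2"
  let ?D = "{\<theta>. - pi < \<theta> \<and> \<theta> \<le> pi \<and> ?f \<theta> \<in> tangent_cone_at K p}"
  \<comment> \<open>Continuity is checked coordinatewise; it makes the direction set Borel, as
    required for monotonicity of the measure.\<close>
  have "?f = (\<lambda>\<theta>. p + (\<chi> i. if i = 1 then cos \<theta> else sin \<theta>))"
    by (auto simp: fun_eq_iff vec_eq_iff forall_2)
  moreover have "continuous_on UNIV (\<lambda>\<theta>. if i = 1 then cos \<theta> else sin \<theta> :: real)" for i :: 2
    by (cases "i = 1") (auto intro!: continuous_intros)
  then have "continuous_on UNIV (\<lambda>\<theta>. p + (\<chi> i. if i = 1 then cos \<theta> else sin \<theta>))"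
    by (intro continuous_on_add continuous_on_const continuous_on_vec_lambda)
  ultimately have "continuous_on UNIV ?f"
    by metis
  moreover have "closed (tangent_cone_at K p)"
    by (simp add: tangent_cone_at_def)
  ultimately have "closed (?f -` tangent_cone_at K p)"
    by (simp add: closed_vimage)
  moreover have "?D = {- pi<..pi} \<inter> ?f -` tangent_cone_at K p"
    by auto
  ultimately have "?D \<in> sets borel"
    by simp
  then have "?D \<in> sets lebesgue"
    by (simp add: sets_completionI_sets)
  moreover have "?D \<subseteq> {\<alpha>..\<beta>}"
  proof
    fix \<theta> assume \<theta>: "\<theta> \<in> ?D"
    then have "?f \<theta> \<in> {q. 0 \<le> u \<bullet> (q - p)}" "?f \<theta> \<in> {q. 0 \<le> w \<bullet> (q - p)}"
      using tangent_cone_at_subset_halfspace[OF assms(1)]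
        tangent_cone_at_subset_halfspace[OF assms(2)] by blast+
    then show "\<theta> \<in> {\<alpha>..\<beta>}"
      using assms(4)[of \<theta>] \<theta> by simp
  qed
  ultimately have "measure lebesgue ?D \<le> measure lebesgue {\<alpha>..\<beta>}"
    by (intro measure_mono_fmeasurable) auto
  then show ?thesis
    using assms(3) by (simp add: body_angle_def angular_measure_def)
qed

text \<open>The interior of the closed half-space is the open one, which misses
  \<open>p\<close>.\<close>

lemma in_frontier_halfspace:
  fixes p u :: "'a::euclidean_space"
  assumes "p \<in> K" "u \<noteq> 0" "K \<subseteq> {q. 0 \<le> u \<bullet> (q - p)}"
  shows "p \<in> frontier K"
proof -
  have "interior K \<subseteq> interior {q. u \<bullet> q \<ge> u \<bullet> p}"
    using assms(3) by (intro interior_mono) (auto simp: inner_diff_right)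
  then have "p \<notin> interior K"
    using assms(2) by auto
  then show ?thesis
    using assms(1) closure_subset by (auto simp: frontier_def)
qed

text \<open>Every segment in \<open>K\<close> issuing from \<open>x\<close> is shorter than
  \<open>r\<close>, hence shorter than the segment from \<open>a\<close> to \<open>b\<close>, hence
  not a diameter.\<close>

lemma not_diametral_pointI:
  assumes "bounded K" "K \<subseteq> ball x r" "a \<in> K" "b \<in> K" "r \<le> dist a b"
  shows "\<not> diametral_point K x"
proof
  assume "diametral_point K x"
  then obtain c d where cd: "closed_segment c d \<subseteq> K" "dist c d = diameter K" "x = c \<or> x = d"
    unfolding diametral_point_def is_diameter_def by blast
  then have "c \<in> ball x r" "d \<in> ball x r"
    using assms(2) by auto
  then have "diameter K < r"
    using cd by (auto simp: dist_commute)
  with diameter_bounded_bound[OF assms(1,3,4)] assms(5) show False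
    by linarith
qed

text \<open>This is \<open>tan \<phi> \<le> m\<close> cleared of its denominator, which keeps the
  endpoints meaningful: at \<open>pi / 2\<close> the hypothesis reads \<open>1 \<le> 0\<close>, and
  at \<open>- pi / 2\<close> the range of \<open>arctan\<close> suffices.\<close>

lemma le_arctan:
  assumes "\<bar>\<phi>\<bar> \<le> pi / 2" "sin \<phi> \<le> m * cos \<phi>"
  shows "\<phi> \<le> arctan m"
proof (cases "\<bar>\<phi>\<bar> = pi / 2")
  case True
  then have "\<phi> = pi / 2 \<or> \<phi> = - (pi / 2)"
    by linarith
  then show ?thesis
  proof
    assume "\<phi> = pi / 2"
    with assms(2) show ?thesis by simp
  next
    assume "\<phi> = - (pi / 2)"
    with arctan_lbound[of m] show ?thesis by simp
  qed
next
  case False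
  then have *: "- (pi / 2) < \<phi>" "\<phi> < pi / 2"
    using assms(1) by linarith+
  then have "tan \<phi> \<le> m"
    using assms(2) cos_gt_zero_pi[OF *] by (simp add: tan_def pos_divide_le_eq)
  then show ?thesis
    using arctan_le_iff[of "tan \<phi>" m] arctan_tan[OF *] by simp
qed

lemma sin_nonneg_imp_nonneg:
  assumes "- pi < \<theta>" "0 \<le> sin \<theta>"
  shows "0 \<le> (\<theta> :: real)"
  using assms sin_gt_zero[of "- \<theta>"] by force

lemma sin_neg_imp_neg:
  assumes "\<theta> \<le> pi" "sin \<theta> < 0"
  shows "\<theta> < (0 :: real)"
  using assms sin_ge_zero[of \<theta>] by force

text \<open>The bounds stay explicit in \<open>t\<close>, leaving the limit to the final theorem.
  The condition \<open>t < 1\<close> keeps both \<open>sqrt 3 - t\<close> and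
  \<open>1 - t\<^sup>2\<close> positive.\<close>

lemma pentagon:
  fixes t :: real
  assumes t: "0 < t" "t < 1"
  obtains K x y z where "planar_convex_body K"
    "x \<in> frontier K" "y \<in> frontier K" "z \<in> frontier K" "x \<noteq> y" "y \<noteq> z" "x \<noteq> z"
    "body_angle K x \<le> 2 * arctan (1 / (sqrt 3 - t))"
    "body_angle K y \<le> pi / 2 + arctan t" "body_angle K z \<le> pi / 2 + arctan t"
    "\<not> diametral_point K x" "\<not> diametral_point K y" "\<not> diametral_point K z"
proof
  define h where "h = sqrt 3 - t"
  \<comment> \<open>The tangent of half the angle at \<open>x\<close>: half the base
    \<open>ab\<close> over the height of \<open>x\<close>.\<close>
  define m where "m = 1 / h"
  define s where "s = 1 - t\<^sup>2"
  define a b x y z :: "real^2" where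
    "a = vector [-1, 0]" and "b = vector [1, 0]" and "x = vector [0, h]" and
    "y = vector [s, - t]" and "z = vector [- s, - t]"
  note vdefs = a_def b_def x_def y_def z_def
  define V where "V = {a, b, x, y, z}"
  define K where "K = convex hull V"
  have sqrt3: "1 < sqrt 3" by simp
  have h: "0 < h" "h < sqrt 3" using t sqrt3 unfolding h_def by linarith+
  have m: "0 < m" "m * h = 1" using h by (auto simp: m_def)
  have s: "0 < s" "s < 1" using t by (auto simp: s_def power_less_one_iff)
  have VK: "V \<subseteq> K" by (simp add: K_def hull_subset)
  have compact: "compact K"
    by (simp add: K_def V_def finite_imp_compact_convex_hull)
  have convex: "convex K" by (simp add: K_def)
  have ball: "K \<subseteq> ball p 2" if "V \<subseteq> ball p 2" for p
    using that by (simp add: K_def hull_minimal)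
  have halfspace: "K \<subseteq> {q. 0 \<le> u \<bullet> (q - p)}" if "V \<subseteq> {q. 0 \<le> u \<bullet> (q - p)}" for u p
  proof -
    have "{q. 0 \<le> u \<bullet> (q - p)} = {q. u \<bullet> q \<ge> u \<bullet> p}"
      by (simp add: inner_diff_right)
    then have "convex {q. 0 \<le> u \<bullet> (q - p)}"
      by (simp add: convex_halfspace_ge)
    then show ?thesis
      using that by (simp add: K_def hull_minimal)
  qed
  show "planar_convex_body K"
  proof (unfold planar_convex_body_def, intro conjI notI)
    assume "interior K = {}"
    \<comment> \<open>A convex set without interior lies on a line. Here \<open>a\<close> and
      \<open>b\<close> force the first coordinate of its normal and \<open>c\<close> to vanish, then
      \<open>x\<close> kills the second.\<close>
    then obtain u c where u: "u \<noteq> 0" "K \<subseteq> {q. u \<bullet> q = c}"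
      using empty_interior_subset_hyperplane[OF convex] by metis
    then have "u \<bullet> a = c" "u \<bullet> b = c" "u \<bullet> x = c"
      using VK by (auto simp: V_def)
    then have "u $ 1 = 0" "u $ 2 = 0"
      using h by (auto simp: vdefs inner_vec_def sum_2)
    with u(1) show False by (simp add: vec_eq_iff forall_2)
  qed (fact compact convex)+

  \<comment> \<open>Distances between the vertices\<close>
  have t2: "t\<^sup>2 < 1" using t by (simp add: power_less_one_iff)
  have h2: "h\<^sup>2 < 3"
    using power_strict_mono[of h "sqrt 3" 2] h by simp
  \<comment> \<open>The height difference between \<open>x\<close> and \<open>y\<close> or
    \<open>z\<close> is exactly \<open>sqrt 3\<close>, so the squared distance is
    \<open>s\<^sup>2 + 3 < 4\<close>. The second form covers subtraction in the other order.\<close>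
  have ht: "(h + t)\<^sup>2 = 3" "(- t - h)\<^sup>2 = 3"
    by (simp_all add: h_def power2_eq_square)
  have s2: "s\<^sup>2 < 1" using s by (simp add: power_less_one_iff)
  have st: "(1 + s)\<^sup>2 + t\<^sup>2 < 4" "(- 1 - s)\<^sup>2 + t\<^sup>2 < 4"
  proof -
    \<comment> \<open>Since \<open>1 + s = 2 - t\<^sup>2\<close>, moving inwards gains
      \<open>4 * t\<^sup>2 - t ^ 4\<close>, against a loss of only \<open>t\<^sup>2\<close> from the
      vertical offset.\<close>
    have "4 - ((1 + s)\<^sup>2 + t\<^sup>2) = t\<^sup>2 * (3 - t\<^sup>2)"
      by (simp add: s_def power2_eq_square algebra_simps)
    moreover have "0 < t\<^sup>2 * (3 - t\<^sup>2)" using t t2 by simp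
    ultimately show "(1 + s)\<^sup>2 + t\<^sup>2 < 4" by linarith
    moreover have "(- 1 - s)\<^sup>2 = (1 + s)\<^sup>2" by (simp add: power2_eq_square algebra_simps)
    ultimately show "(- 1 - s)\<^sup>2 + t\<^sup>2 < 4" by simp
  qed
  have st': "(s - 1)\<^sup>2 + t\<^sup>2 < 4" "(1 - s)\<^sup>2 + t\<^sup>2 < 4" "(2 * s)\<^sup>2 < 4"
    using st s s2 by (simp_all add: power2_eq_square algebra_simps)
  have sqrt_lt: "sqrt r < 2" if "r < 4" for r
    using real_sqrt_less_mono[OF that] by simp
  have "V \<subseteq> ball x 2" "V \<subseteq> ball y 2" "V \<subseteq> ball z 2"
    using st st' s2 ht h2
    by (auto simp: V_def vdefs dist_vector_2 power2_commute intro!: sqrt_lt)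
  then have balls: "K \<subseteq> ball x 2" "K \<subseteq> ball y 2" "K \<subseteq> ball z 2"
    using ball by auto
  have "dist a b = 2" by (simp add: vdefs dist_vector_2)
  then have "\<not> diametral_point K p" if "K \<subseteq> ball p 2" for p
    using that VK compact_imp_bounded[OF compact]
    by (intro not_diametral_pointI[where a = a and b = b and r = 2]) (auto simp: V_def)
  with balls show "\<not> diametral_point K x" "\<not> diametral_point K y" "\<not> diametral_point K z"
    by auto

  \<comment> \<open>Supporting lines at \<open>x\<close>, \<open>y\<close> and
    \<open>z\<close>\<close>
  have "m * (h + t) \<ge> 1" using m t by (simp add: distrib_left)
  \<comment> \<open>The two normals belong to the lines \<open>xa\<close> and \<open>xb\<close>. The
    vertices \<open>y\<close> and \<open>z\<close> lie below both because
    \<open>s < 1 \<le> m * (h + t)\<close>.\<close>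
  then have "V \<subseteq> {q. 0 \<le> vector [1, - m] \<bullet> (q - x)}" "V \<subseteq> {q. 0 \<le> vector [-1, - m] \<bullet> (q - x)}"
    using m s by (auto simp: V_def vdefs inner_vector_2 algebra_simps)
  then have Kx: "K \<subseteq> {q. 0 \<le> vector [1, - m] \<bullet> (q - x)}" "K \<subseteq> {q. 0 \<le> vector [-1, - m] \<bullet> (q - x)}"
    using halfspace by auto
  \<comment> \<open>The lines are \<open>yz\<close>, \<open>yb\<close> and \<open>za\<close>. As
    \<open>1 - s = t\<^sup>2\<close>, the last two have normals exactly \<open>(-1, t)\<close> and
    \<open>(1, t)\<close>.\<close>
  have "V \<subseteq> {q. 0 \<le> vector [0, 1] \<bullet> (q - y)}" "V \<subseteq> {q. 0 \<le> vector [-1, t] \<bullet> (q - y)}"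
    "V \<subseteq> {q. 0 \<le> vector [0, 1] \<bullet> (q - z)}" "V \<subseteq> {q. 0 \<le> vector [1, t] \<bullet> (q - z)}"
    using t s h by (auto simp: V_def vdefs inner_vector_2)
      (simp_all add: s_def power2_eq_square)
  then have Ky: "K \<subseteq> {q. 0 \<le> vector [0, 1] \<bullet> (q - y)}" "K \<subseteq> {q. 0 \<le> vector [-1, t] \<bullet> (q - y)}"
    and Kz: "K \<subseteq> {q. 0 \<le> vector [0, 1] \<bullet> (q - z)}" "K \<subseteq> {q. 0 \<le> vector [1, t] \<bullet> (q - z)}"
    using halfspace by auto
  have "(vector [1, - m] :: real^2) \<noteq> 0" "(vector [0, 1] :: real^2) \<noteq> 0"
    by (auto simp: vec_eq_iff forall_2)
  then show "x \<in> frontier K" "y \<in> frontier K" "z \<in> frontier K"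
    using VK Kx(1) Ky(1) Kz(1) in_frontier_halfspace by (auto simp: V_def)
  show "x \<noteq> y" "y \<noteq> z" "x \<noteq> z"
    using s h t by (auto simp: vdefs vec_eq_iff forall_2)

  \<comment> \<open>Angles at \<open>x\<close>, \<open>y\<close> and \<open>z\<close>\<close>
  have "body_angle K x \<le> (- (pi / 2) + arctan m) - (- (pi / 2) - arctan m)"
  proof (rule body_angle_le[OF Kx])
    fix \<theta> assume \<theta>: "- pi < \<theta>" "\<theta> \<le> pi" "0 \<le> vector [1, - m] \<bullet> (vector [cos \<theta>, sin \<theta>] :: real^2)"
      "0 \<le> vector [- 1, - m] \<bullet> (vector [cos \<theta>, sin \<theta>] :: real^2)"
    then have *: "- cos \<theta> \<le> - m * sin \<theta>" "cos \<theta> \<le> - m * sin \<theta>"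
      by (auto simp: inner_vector_2)
    then have "m * sin \<theta> \<le> 0" by linarith
    then have "sin \<theta> \<le> 0" using m by (simp add: mult_le_0_iff)
    \<comment> \<open>A horizontal direction would need \<open>cos \<theta> = 0\<close> as well;
      excluding it leaves only negative \<open>\<theta>\<close>.\<close>
    moreover have "sin \<theta> \<noteq> 0"
    proof
      assume "sin \<theta> = 0"
      with * have "cos \<theta> = 0" by simp
      with \<open>sin \<theta> = 0\<close> show False using sin_zero_abs_cos_one by force
    qed
    ultimately have "\<theta> < 0" using sin_neg_imp_neg[of \<theta>] \<theta> by simp
    \<comment> \<open>The angle is bisected by the downward direction \<open>- pi / 2\<close>. For
      \<open>\<phi> = \<theta> + pi / 2\<close>, \<open>cos \<theta>\<close> becomes
      \<open>sin \<phi>\<close> and \<open>- sin \<theta>\<close> becomes \<open>cos \<phi>\<close>,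
      so \<open>*\<close> bounds both \<open>\<phi>\<close> and \<open>- \<phi>\<close> by
      \<open>arctan m\<close>.\<close>
    then have "\<bar>\<theta> + pi / 2\<bar> \<le> pi / 2" using \<theta> by linarith
    then have "\<theta> + pi / 2 \<le> arctan m" "- (\<theta> + pi / 2) \<le> arctan m"
      using * le_arctan[of "\<theta> + pi / 2" m] le_arctan[of "- (\<theta> + pi / 2)" m]
      unfolding abs_minus sin_minus cos_minus by (auto simp: sin_add cos_add)
    then show "- (pi / 2) - arctan m \<le> \<theta> \<and> \<theta> \<le> - (pi / 2) + arctan m"
      by linarith
  qed (use m in simp)
  then show "body_angle K x \<le> 2 * arctan (1 / (sqrt 3 - t))"
    by (simp add: m_def h_def)
  \<comment> \<open>Directions run from that of \<open>b\<close>, at \<open>arctan t\<close> to the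
    right of the vertical, to that of \<open>z\<close>, which is \<open>pi\<close>; the cut at
    \<open>pi\<close> does not split this range.\<close>
  have "body_angle K y \<le> pi - (pi / 2 - arctan t)"
  proof (rule body_angle_le[OF Ky])
    show "pi / 2 - arctan t \<le> pi" using t pi_gt_zero zero_less_arctan_iff[of t] by linarith
    fix \<theta> assume \<theta>: "- pi < \<theta>" "\<theta> \<le> pi" "0 \<le> vector [0, 1] \<bullet> (vector [cos \<theta>, sin \<theta>] :: real^2)"
      "0 \<le> vector [- 1, t] \<bullet> (vector [cos \<theta>, sin \<theta>] :: real^2)"
    then have *: "0 \<le> sin \<theta>" "cos \<theta> \<le> t * sin \<theta>"
      by (auto simp: inner_vector_2)
    then have "\<bar>pi / 2 - \<theta>\<bar> \<le> pi / 2"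
      using \<theta> sin_nonneg_imp_nonneg[of \<theta>] by linarith
    then have "pi / 2 - \<theta> \<le> arctan t"
      using * by (intro le_arctan) (auto simp: sin_diff cos_diff)
    then show "pi / 2 - arctan t \<le> \<theta> \<and> \<theta> \<le> pi" using \<theta> by linarith
  qed
  then show "body_angle K y \<le> pi / 2 + arctan t" by simp
  \<comment> \<open>The mirror image: directions run from that of \<open>y\<close>, which is
    \<open>0\<close>, to that of \<open>a\<close>.\<close>
  have "body_angle K z \<le> (pi / 2 + arctan t) - 0"
  proof (rule body_angle_le[OF Kz])
    show "0 \<le> pi / 2 + arctan t" using t pi_gt_zero zero_less_arctan_iff[of t] by linarith
    fix \<theta> assume \<theta>: "- pi < \<theta>" "\<theta> \<le> pi" "0 \<le> vector [0, 1] \<bullet> (vector [cos \<theta>, sin \<theta>] :: real^2)"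
      "0 \<le> vector [1, t] \<bullet> (vector [cos \<theta>, sin \<theta>] :: real^2)"
    then have *: "0 \<le> sin \<theta>" "- cos \<theta> \<le> t * sin \<theta>"
      by (auto simp: inner_vector_2)
    then have "\<bar>\<theta> - pi / 2\<bar> \<le> pi / 2"
      using \<theta> sin_nonneg_imp_nonneg[of \<theta>] by linarith
    then have "\<theta> - pi / 2 \<le> arctan t"
      using * by (intro le_arctan) (auto simp: sin_diff cos_diff)
    then show "0 \<le> \<theta> \<and> \<theta> \<le> pi / 2 + arctan t"
      using \<theta> * sin_nonneg_imp_nonneg[of \<theta>] by linarith
  qed
  then show "body_angle K z \<le> pi / 2 + arctan t" by simp
qed

theorem mainTheorem5:
  fixes \<epsilon> :: real
  assumes "\<epsilon> > 0"
  shows "(\<exists>K x. planar_convex_body K \<and> x \<in> frontier K \<and>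
            body_angle K x \<le> pi / 3 + \<epsilon> \<and>
            \<not> diametral_point K x)
       \<and> (\<exists>K x y. planar_convex_body K \<and> x \<in> frontier K \<and> y \<in> frontier K \<and> x \<noteq> y \<and>
            body_angle K x + body_angle K y \<le> 5 * pi / 6 + \<epsilon> \<and>
            \<not> diametral_point K x \<and> \<not> diametral_point K y)
       \<and> (\<exists>K x y z. planar_convex_body K \<and>
            x \<in> frontier K \<and> y \<in> frontier K \<and> z \<in> frontier K \<and>
            x \<noteq> y \<and> y \<noteq> z \<and> x \<noteq> z \<and>
            body_angle K x + body_angle K y + body_angle K z \<le> 4 * pi / 3 + \<epsilon> \<and>
            \<not> diametral_point K x \<and> \<not> diametral_point K y \<and> \<not> diametral_point K z)"
proof -
  have "arctan (1 / sqrt 3) = pi / 6"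
    using arctan_tan[of "pi / 6"] tan_30 by simp
  then have lim: "2 * arctan (1 / (sqrt 3 - 0)) = pi / 3"
    by simp
  have "((\<lambda>t. 2 * arctan (1 / (sqrt 3 - t))) \<longlongrightarrow> 2 * arctan (1 / (sqrt 3 - 0))) (at_right 0)"
    by (intro tendsto_intros) simp
  \<comment> \<open>An error of \<open>\<epsilon> / 3\<close> per vertex adds up to at most
    \<open>\<epsilon>\<close> for three vertices, so one \<open>t\<close> serves all three parts.
    The limits are \<open>pi / 3\<close>, then \<open>pi / 3 + pi / 2 = 5 * pi / 6\<close>, then
    \<open>pi / 3 + pi = 4 * pi / 3\<close>.\<close>
  then have "\<forall>\<^sub>F t in at_right 0. 2 * arctan (1 / (sqrt 3 - t)) < pi / 3 + \<epsilon> / 3"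
    by (rule order_tendstoD) (unfold lim, use assms in simp)
  moreover have "(arctan \<longlongrightarrow> arctan 0) (at_right 0)"
    by (intro tendsto_intros)
  then have "\<forall>\<^sub>F t in at_right 0. arctan t < \<epsilon> / 3"
    by (rule order_tendstoD) (use assms in simp)
  moreover have "\<forall>\<^sub>F t in at_right 0. t \<in> {0<..<1::real}"
    by (rule eventually_at_right_real) simp
  ultimately have "\<forall>\<^sub>F t in at_right 0. 2 * arctan (1 / (sqrt 3 - t)) < pi / 3 + \<epsilon> / 3 \<and>
      arctan t < \<epsilon> / 3 \<and> t \<in> {0<..<1}"
    by eventually_elim simp
  then obtain t where t: "2 * arctan (1 / (sqrt 3 - t)) < pi / 3 + \<epsilon> / 3"
      "arctan t < \<epsilon> / 3" "0 < t" "t < 1"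
    using eventually_happens'[OF trivial_limit_at_right_real] by fastforce
  obtain K x y z where K: "planar_convex_body K"
    "x \<in> frontier K" "y \<in> frontier K" "z \<in> frontier K" "x \<noteq> y" "y \<noteq> z" "x \<noteq> z"
    "body_angle K x \<le> 2 * arctan (1 / (sqrt 3 - t))"
    "body_angle K y \<le> pi / 2 + arctan t" "body_angle K z \<le> pi / 2 + arctan t"
    "\<not> diametral_point K x" "\<not> diametral_point K y" "\<not> diametral_point K z"
    by (rule pentagon[OF t(3,4)])
  have "body_angle K x \<le> pi / 3 + \<epsilon>"
    using K(8) t assms by linarith
  moreover have "body_angle K x + body_angle K y \<le> 5 * pi / 6 + \<epsilon>"
    using K(8,9) t assms by linarith
  moreover have "body_angle K x + body_angle K y + body_angle K z \<le> 4 * pi / 3 + \<epsilon>"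
    using K(8,9,10) t by linarith
  ultimately show ?thesis
    using K by (intro conjI) blast+
qed

end
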